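(* Let $0<\beta'<1$ and $\frac12\le\sigma\le1$, and assume that the coefficients $g_{n,k}$ of $\delta_t^{\beta',*}$ satisfy (P1) $g_{n,k+1}>g_{n,k}>0$ for $1\le k\le n-1\le N-1$; (P2) $(2\sigma-1)g_{n,n}>\sigma g_{n,n-1}$ for $2\le n\le N$. Let $\{v_1^n\}_{n=0}^N$ and $\{v_2^n\}_{n=0}^N$ be sequences in $\Pi_h$ and put $\xi^n=\sqrt{\|v_1^n\|^2+\|v_2^n\|^2}$. Then for $n=1,\dots,N$, $$(\delta_t^{\beta',*}v_1^n,v_1^{n,*})+(\delta_t^{\beta',*}v_2^n,v_2^{n,*})\ \ge\ \left[\sigma\xi^n+(1-\sigma)\xi^{n-1}\right]\delta_t^{\beta',*}\xi^n.$$
   Context: Temporal mesh: $0=t_0<t_1<\dots<t_N=T$, $\tau_n=t_n-t_{n-1}$, $t_n^*=t_n-(1-\sigma)\tau_n$; for a sequence $v^n$, $v^{n,*}=\sigma v^n+(1-\sigma)v^{n-1}$. (In the paper the mesh belongs to a quasi-graded family: $\tau_1\simeq N^{-r}$, $t_n\simeq\tau_1n^r$, $\tau_n\simeq\tau_1^{1/r}t_n^{1-1/r}$, $r\ge1$, with equivalence constants independent of $n,N$.) Discrete derivative of order $\beta'$: $\delta_t^{\beta',*}v^n=\frac1{\Gamma(1-\beta')}\Bigl[\sum_{k=1}^{n-1}\int_{t_{k-1}}^{t_k}(t_n^*-s)^{-\beta'}\partial_s\Pi_{2,k}v(s)\,ds+\int_{t_{n-1}}^{t_n^*}(t_n^*-s)^{-\beta'}\partial_s\Pi_{1,n}v(s)\,ds\Bigr]$,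 where $\Pi_{2,k}v$ is the quadratic polynomial in time with values $v^{k-1},v^k,v^{k+1}$ at $t_{k-1},t_k,t_{k+1}$ and $\Pi_{1,n}v$ is the linear one with values $v^{n-1},v^n$ at $t_{n-1},t_n$. Writing $\delta_t^{\beta',*}v^n=\sum_{k=1}^ng_{n,k}(v^k-v^{k-1})$ defines the real coefficients $g_{n,k}$; the operator is applied both to real sequences and (pointwise) to sequences of grid functions. Space grid: $h=L/M$, $\bar\Omega_h=\{(ih,jh):0\le i,j\le M\}$, $\partial\Omega_h$ its points on the boundary of $(0,L)^2$. $\Pi_h$ is the space of real grid functions on $\bar\Omega_h$ vanishing on $\partial\Omega_h$, with $(U,V)=h^2\sum_{i=1}^{M-1}\sum_{j=1}^{M-1}U_{i,j}V_{i,j}$ and $\|U\|=\sqrt{(U,U)}$. *)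

theory Defs
  imports "HOL-Analysis.Analysis"
begin

definition temporal_mesh :: "nat \<Rightarrow> real \<Rightarrow> (nat \<Rightarrow> real) \<Rightarrow> bool" where
  "temporal_mesh N T t \<longleftrightarrow>
     1 \<le> N \<and> t 0 = 0 \<and> (\<forall>n\<in>{1..N}. t (n - 1) < t n) \<and> t N = T"

definition tau :: "(nat \<Rightarrow> real) \<Rightarrow> nat \<Rightarrow> real" where
  "tau t n = t n - t (n - 1)"

definition tstar :: "(nat \<Rightarrow> real) \<Rightarrow> real \<Rightarrow> nat \<Rightarrow> real" where
  "tstar t \<sigma> n = t n - (1 - \<sigma>) * tau t n"

text \<open>Linear and quadratic interpolants in time, in Lagrange form.\<close>

definition Pi1 :: "(nat \<Rightarrow> real) \<Rightarrow> nat \<Rightarrow> (nat \<Rightarrow> real) \<Rightarrow> real \<Rightarrow> real" where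
  "Pi1 t n v s =
     v (n - 1) * ((s - t n) / (t (n - 1) - t n)) +
     v n * ((s - t (n - 1)) / (t n - t (n - 1)))"

definition Pi2 :: "(nat \<Rightarrow> real) \<Rightarrow> nat \<Rightarrow> (nat \<Rightarrow> real) \<Rightarrow> real \<Rightarrow> real" where
  "Pi2 t k v s =
     v (k - 1) * ((s - t k) * (s - t (k + 1)) / ((t (k - 1) - t k) * (t (k - 1) - t (k + 1)))) +
     v k * ((s - t (k - 1)) * (s - t (k + 1)) / ((t k - t (k - 1)) * (t k - t (k + 1)))) +
     v (k + 1) * ((s - t (k - 1)) * (s - t k) / ((t (k + 1) - t (k - 1)) * (t (k + 1) - t k)))"

text \<open>In the last integral the kernel is singular at the right end point; there
  \<open>0 powr (- \<beta>) = 0\<close> by convention, which does not affect the integral.\<close>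

definition delta :: "(nat \<Rightarrow> real) \<Rightarrow> real \<Rightarrow> real \<Rightarrow> (nat \<Rightarrow> real) \<Rightarrow> nat \<Rightarrow> real" where
  "delta t \<sigma> \<beta> v n =
     1 / Gamma (1 - \<beta>) *
      ((\<Sum>k=1..n - 1. integral {t (k - 1)..t k}
          (\<lambda>s. (tstar t \<sigma> n - s) powr (- \<beta>) * deriv (Pi2 t k v) s)) +
       integral {t (n - 1)..tstar t \<sigma> n}
          (\<lambda>s. (tstar t \<sigma> n - s) powr (- \<beta>) * deriv (Pi1 t n v) s))"

text \<open>The coefficients are specified by the expansion of \<open>delta\<close> in the increments of
  the sequence. Lemmas \<open>delta_eq_sum_gcoeff\<close> and \<open>gcoeff_unique\<close> below show that the
  values \<open>gcoeff t \<sigma> \<beta> n k\<close> for \<open>1 \<le> k \<le> n\<close> exist and are uniquely determined; the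
  values for other \<open>k\<close> are irrelevant.\<close>

definition gcoeff :: "(nat \<Rightarrow> real) \<Rightarrow> real \<Rightarrow> real \<Rightarrow> nat \<Rightarrow> nat \<Rightarrow> real" where
  "gcoeff t \<sigma> \<beta> n =
     (SOME g. \<forall>v. delta t \<sigma> \<beta> v n = (\<Sum>k=1..n. g k * (v k - v (k - 1))))"

text \<open>A grid function is a function on the plane that is \<open>0\<close> off the grid, so that
  the elements of \<open>grid_space\<close> correspond bijectively to functions on the grid that
  vanish at its boundary points.\<close>

type_synonym grid_fun = "real \<times> real \<Rightarrow> real"

definition grid_point :: "real \<Rightarrow> nat \<Rightarrow> nat \<Rightarrow> nat \<Rightarrow> real \<times> real" where
  "grid_point L M i j = (real i * (L / real M), real j * (L / real M))"

definition grid :: "real \<Rightarrow> nat \<Rightarrow> (real \<times> real) set" where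
  "grid L M = {grid_point L M i j | i j. i \<le> M \<and> j \<le> M}"

definition grid_boundary :: "real \<Rightarrow> nat \<Rightarrow> (real \<times> real) set" where
  "grid_boundary L M = grid L M \<inter> frontier ({0<..<L} \<times> {0<..<L})"

definition grid_space :: "real \<Rightarrow> nat \<Rightarrow> grid_fun set" where
  "grid_space L M = {U. (\<forall>p. p \<notin> grid L M \<longrightarrow> U p = 0) \<and> (\<forall>p\<in>grid_boundary L M. U p = 0)}"

definition grid_inner :: "real \<Rightarrow> nat \<Rightarrow> grid_fun \<Rightarrow> grid_fun \<Rightarrow> real" where
  "grid_inner L M U V =
     (L / real M)\<^sup>2 *
       (\<Sum>i=1..M - 1. \<Sum>j=1..M - 1. U (grid_point L M i j) * V (grid_point L M i j))"

definition grid_norm :: "real \<Rightarrow> nat \<Rightarrow> grid_fun \<Rightarrow> real" where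
  "grid_norm L M U = sqrt (grid_inner L M U U)"

definition delta_grid ::
  "(nat \<Rightarrow> real) \<Rightarrow> real \<Rightarrow> real \<Rightarrow> (nat \<Rightarrow> grid_fun) \<Rightarrow> nat \<Rightarrow> grid_fun" where
  "delta_grid t \<sigma> \<beta> v n = (\<lambda>p. delta t \<sigma> \<beta> (\<lambda>m. v m p) n)"

definition star_grid :: "real \<Rightarrow> (nat \<Rightarrow> grid_fun) \<Rightarrow> nat \<Rightarrow> grid_fun" where
  "star_grid \<sigma> v n = (\<lambda>p. \<sigma> * v n p + (1 - \<sigma>) * v (n - 1) p)"

lemma temporal_mesh_less:
  assumes "temporal_mesh N T t" "k < n" "n \<le> N"
  shows "t k < t n"
  using assms(2,3)
proof (induction n)
  case (Suc n)
  have "t n < t (Suc n)"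
    using assms(1) Suc.prems unfolding temporal_mesh_def
    by (auto dest: bspec[of _ _ "Suc n"])
  then show ?case using Suc by (cases "k = n") auto
qed simp

lemma Pi1_interpolates:
  assumes "t (n - 1) < t n"
  shows "Pi1 t n v (t (n - 1)) = v (n - 1)" "Pi1 t n v (t n) = v n"
  using assms by (simp_all add: Pi1_def)

lemma Pi2_interpolates:
  assumes "t (k - 1) < t k" "t k < t (k + 1)"
  shows "Pi2 t k v (t (k - 1)) = v (k - 1)" "Pi2 t k v (t k) = v k"
    "Pi2 t k v (t (k + 1)) = v (k + 1)"
  using assms by (auto simp: Pi2_def)

lemma deriv_Pi1:
  assumes "t (n - 1) < t n"
  shows "deriv (Pi1 t n v) s = (v n - v (n - 1)) / tau t n"
proof -
  have neq: "t (n - 1) \<noteq> t n" using assms by simp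
  have "((\<lambda>s. v (n - 1) * ((s - t n) / (t (n - 1) - t n)) +
     v n * ((s - t (n - 1)) / (t n - t (n - 1)))) has_field_derivative
      (v (n - 1) * (1 / (t (n - 1) - t n)) + v n * (1 / (t n - t (n - 1))))) (at s)"
    using neq by (auto intro!: derivative_eq_intros simp del: One_nat_def)
  also have "v (n - 1) * (1 / (t (n - 1) - t n)) + v n * (1 / (t n - t (n - 1)))
      = (v n - v (n - 1)) / tau t n"
    using assms by (simp add: tau_def divide_simps) (simp add: algebra_simps)
  finally show ?thesis
    unfolding Pi1_def by (intro DERIV_imp_deriv) (simp add: Pi1_def)
qed

lemma deriv_Pi2:
  assumes "t (k - 1) < t k" "t k < t (k + 1)"
  shows "deriv (Pi2 t k v) s =
     (t k + t (k + 1) - 2 * s) / ((t k - t (k - 1)) * (t (k + 1) - t (k - 1))) * (v k - v (k - 1)) +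
     (2 * s - t (k - 1) - t k) / ((t (k + 1) - t (k - 1)) * (t (k + 1) - t k)) * (v (k + 1) - v k)"
proof -
  define a b c where abc: "a = t (k - 1)" "b = t k" "c = t (k + 1)"
  have lt: "a < b" "b < c" using assms by (auto simp: abc)
  define x y z where xyz: "x = v (k - 1)" "y = v k" "z = v (k + 1)"
  define X Y Z where XYZ: "X = x / ((a - b) * (a - c))" "Y = y / ((b - a) * (b - c))"
    "Z = z / ((c - a) * (c - b))"
  have Pi2: "Pi2 t k v = (\<lambda>s. X * ((s - b) * (s - c)) + Y * ((s - a) * (s - c)) +
     Z * ((s - a) * (s - b)))"
    by (auto simp: Pi2_def abc xyz XYZ)
  have "(Pi2 t k v has_field_derivative
      (X * (2 * s - b - c) + Y * (2 * s - a - c) + Z * (2 * s - a - b))) (at s)"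
    unfolding Pi2 by (auto intro!: derivative_eq_intros simp: algebra_simps)
  then have "(Pi2 t k v has_field_derivative
      (x * ((2 * s - b - c) / ((a - b) * (a - c))) +
       y * ((2 * s - a - c) / ((b - a) * (b - c))) +
       z * ((2 * s - a - b) / ((c - a) * (c - b))))) (at s)"
    by (simp add: XYZ)
  moreover define p q where pq: "p = b - a" "q = c - b"
  have "b = a + p" "c = a + p + q" "p > 0" "q > 0" using lt by (auto simp: pq)
  then have "x * ((2 * s - b - c) / ((a - b) * (a - c))) +
       y * ((2 * s - a - c) / ((b - a) * (b - c))) +
       z * ((2 * s - a - b) / ((c - a) * (c - b)))
     = (b + c - 2 * s) / ((b - a) * (c - a)) * (y - x) +
       (2 * s - a - b) / ((c - a) * (c - b)) * (z - y)"
    by (simp add: divide_simps add_pos_pos) (simp add: algebra_simps)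
  ultimately show ?thesis
    unfolding abc xyz by (metis DERIV_imp_deriv)
qed

lemma tstar_gt:
  assumes "temporal_mesh N T t" "1 \<le> n" "n \<le> N" "0 < \<sigma>"
  shows "t (n - 1) < tstar t \<sigma> n"
proof -
  have "0 < \<sigma> * (t n - t (n - 1))"
    using temporal_mesh_less[OF assms(1), of "n - 1" n] assms by simp
  then show ?thesis by (simp add: tstar_def tau_def algebra_simps)
qed

lemma gcoeff_exists:
  assumes mesh: "temporal_mesh N T t" and n: "1 \<le> n" "n \<le> N" and \<sigma>: "0 < \<sigma>"
  shows "\<exists>g. \<forall>v. delta t \<sigma> \<beta> v n = (\<Sum>k=1..n. g k * (v k - v (k - 1)))"
proof -
  let ?K = "\<lambda>s. (tstar t \<sigma> n - s) powr (- \<beta>)"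
  define a where "a k s =
    (t k + t (k + 1) - 2 * s) / ((t k - t (k - 1)) * (t (k + 1) - t (k - 1)))" for k s
  define b where "b k s =
    (2 * s - t (k - 1) - t k) / ((t (k + 1) - t (k - 1)) * (t (k + 1) - t k))" for k s
  define A where "A k = integral {t (k - 1)..t k} (\<lambda>s. ?K s * a k s)" for k
  define B where "B k = integral {t (k - 1)..t k} (\<lambda>s. ?K s * b k s)" for k
  define C where "C = integral {t (n - 1)..tstar t \<sigma> n} ?K / tau t n"
  define g where "g k = 1 / Gamma (1 - \<beta>) *
    ((if k < n then A k else 0) + (if 1 < k then B (k - 1) else 0) + (if k = n then C else 0))" for k
  have "delta t \<sigma> \<beta> v n = (\<Sum>k=1..n. g k * (v k - v (k - 1)))" for v
  proof -
    define d where "d k = v k - v (k - 1)" for k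
    have I2: "integral {t (k - 1)..t k} (\<lambda>s. ?K s * deriv (Pi2 t k v) s)
        = A k * d k + B k * d (k + 1)" if k: "k \<in> {1..n - 1}" for k
    proof -
      have lt: "t (k - 1) < t k" "t k < t (k + 1)"
        using k n by (auto intro!: temporal_mesh_less[OF mesh])
      have "t k \<le> t (n - 1)"
        using temporal_mesh_less[OF mesh, of k "n - 1"] k n
        by (cases "k = n - 1") (auto simp: less_le)
      then have less: "s < tstar t \<sigma> n" if "s \<in> {t (k - 1)..t k}" for s
        using tstar_gt[OF mesh n \<sigma>] that by auto
      have cK: "continuous_on {t (k - 1)..t k} ?K"
        using less by (intro continuous_intros) force
      have iA: "(\<lambda>s. ?K s * a k s) integrable_on {t (k - 1)..t k}"
        unfolding a_def using lt by (intro integrable_continuous_interval continuous_intros cK) auto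
      have iB: "(\<lambda>s. ?K s * b k s) integrable_on {t (k - 1)..t k}"
        unfolding b_def using lt by (intro integrable_continuous_interval continuous_intros cK) auto
      have "(\<lambda>s. ?K s * deriv (Pi2 t k v) s) =
          (\<lambda>s. ?K s * a k s * d k + ?K s * b k s * d (k + 1))"
        by (simp add: deriv_Pi2[OF lt] a_def b_def d_def algebra_simps)
      then show ?thesis
        using iA iB by (simp add: integral_add integrable_on_mult_left A_def B_def)
    qed
    have "t (n - 1) < t n" using n by (intro temporal_mesh_less[OF mesh]) auto
    then have I1: "integral {t (n - 1)..tstar t \<sigma> n} (\<lambda>s. ?K s * deriv (Pi1 t n v) s) = C * d n"
      by (simp add: deriv_Pi1 C_def d_def)
    have shift: "(\<Sum>k=1..n. (if 1 < k then B (k - 1) else 0) * d k) = (\<Sum>k=1..n-1. B k * d (k + 1))"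
    proof -
      have "(\<Sum>k=1..n. (if 1 < k then B (k - 1) else 0) * d k) = (\<Sum>k\<in>{2..n}. B (k - 1) * d k)"
        by (rule sum.mono_neutral_cong_right) auto
      also have "\<dots> = (\<Sum>k=1..n-1. B k * d (k + 1))"
        by (rule sum.reindex_bij_witness[of _ "\<lambda>k. k + 1" "\<lambda>k. k - 1"]) auto
      finally show ?thesis .
    qed
    have first: "(\<Sum>k=1..n. (if k < n then A k else 0) * d k) = (\<Sum>k=1..n-1. A k * d k)"
      by (rule sum.mono_neutral_cong_right) auto
    have last: "(\<Sum>k=1..n. (if k = n then C else 0) * d k) = C * d n"
      using n by (simp add: if_distrib[of "\<lambda>x. x * _"] sum.delta cong: if_cong)
    have "(\<Sum>k=1..n. g k * d k) = 1 / Gamma (1 - \<beta>) *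
       ((\<Sum>k=1..n. (if k < n then A k else 0) * d k) +
        (\<Sum>k=1..n. (if 1 < k then B (k - 1) else 0) * d k) +
        (\<Sum>k=1..n. (if k = n then C else 0) * d k))"
      unfolding g_def sum.distrib[symmetric] sum_distrib_left
      by (rule sum.cong) (simp_all only: distrib_right mult.assoc)
    also have "\<dots> = delta t \<sigma> \<beta> v n"
      unfolding shift first last delta_def I1 sum.distrib[symmetric]
      by (simp only: I2 cong: sum.cong)
    finally show ?thesis by (simp add: d_def)
  qed
  then show ?thesis by blast
qed

lemma delta_eq_sum_gcoeff:
  assumes "temporal_mesh N T t" "1 \<le> n" "n \<le> N" "0 < \<sigma>"
  shows "delta t \<sigma> \<beta> v n = (\<Sum>k=1..n. gcoeff t \<sigma> \<beta> n k * (v k - v (k - 1)))"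
  unfolding gcoeff_def using someI_ex[OF gcoeff_exists[OF assms]] by blast

lemma gcoeff_unique:
  assumes "temporal_mesh N T t" "1 \<le> n" "n \<le> N" "0 < \<sigma>"
    and g: "\<And>v. delta t \<sigma> \<beta> v n = (\<Sum>k=1..n. g k * (v k - v (k - 1)))"
    and k: "k \<in> {1..n}"
  shows "g k = gcoeff t \<sigma> \<beta> n k"
proof -
  let ?v = "\<lambda>j. if k \<le> j then 1 else 0 :: real"
  have "(\<Sum>j=1..n. c j * (?v j - ?v (j - 1))) = c k" for c :: "nat \<Rightarrow> real"
  proof -
    have "(\<Sum>j=1..n. c j * (?v j - ?v (j - 1))) = (\<Sum>j\<in>{k}. c j)"
      using k by (intro sum.mono_neutral_cong_right) auto
    then show ?thesis by simp
  qed
  then show ?thesis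
    using g[of ?v] delta_eq_sum_gcoeff[OF assms(1-4), of \<beta> ?v] by simp
qed

end

theory Submission
  imports Defs
begin

text \<open>Write \<open>G m k\<close> for the Gram matrix of the pairs \<open>(v\<^sub>1\<^sup>m, v\<^sub>2\<^sup>m)\<close> and
  \<open>D m k = \<xi>\<^sup>m \<xi>\<^sup>k - G m k\<close>, which is nonnegative by Cauchy--Schwarz and vanishes for \<open>m = k\<close>.
  With \<open>H k = \<sigma> D k n + (1 - \<sigma>) D k (n - 1)\<close>, the claim says that
  \<open>\<Sum>k=1..n. g\<^sub>k (H k - H (k - 1)) \<le> 0\<close>. By summation by parts and the monotonicity of \<open>g\<close>, the sum is
  at most \<open>g\<^sub>n H n - (g\<^sub>n - g\<^bsub>n-1\<^esub>) H (n - 1) = (\<sigma> g\<^bsub>n-1\<^esub> - (2 \<sigma> - 1) g\<^sub>n) D n (n - 1)\<close>,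
  which is nonpositive by (P2). For \<open>n = 1\<close>, where (P1) and (P2) are void, one needs
  \<open>g\<^bsub>1,1\<^esub> \<ge> 0\<close>, which follows from the definition of the discrete derivative.\<close>

text \<open>Summation by parts gives \<open>g m * H m\<close> minus \<open>g 1 * H 0\<close> and the
  terms \<open>(g (k + 1) - g k) * H k\<close> for \<open>1 \<le> k < m\<close>; all subtracted
  terms are nonnegative, and the induction drops one at each step.\<close>

lemma sum_increments_le_last:
  fixes g H :: "nat \<Rightarrow> real"
  assumes "1 \<le> m" "0 \<le> g 1" "\<And>k. 1 \<le> k \<Longrightarrow> k < m \<Longrightarrow> g k \<le> g (k + 1)" "\<And>k. 0 \<le> H k"
  shows "(\<Sum>k=1..m. g k * (H k - H (k - 1))) \<le> g m * H m"
  using assms(1,3)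
proof (induction m rule: dec_induct)
  case base
  have "0 \<le> g 1 * H 0"
    using assms(2,4) by simp
  then show ?case by (simp add: algebra_simps)
next
  case (step m)
  have "0 \<le> (g (m + 1) - g m) * H m"
    using step.prems[of m] step.hyps assms(4)[of m] by simp
  then show ?case
    using step by (simp add: algebra_simps)
qed

lemma gram_discrete_derivative_ge:
  fixes g \<xi> :: "nat \<Rightarrow> real" and G :: "nat \<Rightarrow> nat \<Rightarrow> real"
  assumes n: "1 \<le> n" and \<sigma>: "1 / 2 \<le> \<sigma>" "\<sigma> \<le> 1"
    and g1: "0 \<le> g 1"
    and mono: "\<And>k. 1 \<le> k \<Longrightarrow> k < n \<Longrightarrow> g k \<le> g (k + 1)"
    and last: "2 \<le> n \<Longrightarrow> \<sigma> * g (n - 1) \<le> (2 * \<sigma> - 1) * g n"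
    and diag: "\<And>m. G m m = \<xi> m * \<xi> m"
    and sym: "\<And>k m. G k m = G m k"
    and CS: "\<And>k m. G k m \<le> \<xi> k * \<xi> m"
  shows "(\<sigma> * \<xi> n + (1 - \<sigma>) * \<xi> (n - 1)) * (\<Sum>k=1..n. g k * (\<xi> k - \<xi> (k - 1)))
    \<le> (\<Sum>k=1..n. g k * (\<sigma> * (G k n - G (k - 1) n) + (1 - \<sigma>) * (G k (n - 1) - G (k - 1) (n - 1))))"
proof -
  define D where "D k m = \<xi> k * \<xi> m - G k m" for k m
  define H where "H k = \<sigma> * D k n + (1 - \<sigma>) * D k (n - 1)" for k
  have H0: "0 \<le> H k" for k
    using CS \<sigma> by (auto simp: H_def D_def intro!: add_nonneg_nonneg mult_nonneg_nonneg)
  have D0: "0 \<le> D n (n - 1)" using CS by (simp add: D_def)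
  \<comment> \<open>Since \<open>D\<close> is symmetric with zero diagonal, the last two values of
    \<open>H\<close> are multiples of the single number \<open>D n (n - 1)\<close>.\<close>
  have Hn: "H n = (1 - \<sigma>) * D n (n - 1)" by (simp add: H_def D_def diag)
  have Hn1: "H (n - 1) = \<sigma> * D n (n - 1)"
    using sym[of n "n - 1"] by (simp add: H_def D_def diag mult.commute)
  have "(\<Sum>k=1..n. g k * (H k - H (k - 1))) \<le> 0"
  proof (cases "n = 1")
    case True
    have "0 \<le> g 1 * ((2 * \<sigma> - 1) * D n (n - 1))"
      using g1 \<sigma> D0 by (intro mult_nonneg_nonneg) auto
    also have "\<dots> = g 1 * (H (n - 1) - H n)"
      unfolding Hn Hn1 by (simp add: algebra_simps)
    finally show ?thesis using True by (simp add: algebra_simps)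
  next
    case False
    then obtain m where m: "n = Suc m" "1 \<le> m" using n by (cases n) auto
    then have m': "n - 1 = m" by simp
    \<comment> \<open>The bound stops at \<open>n - 1\<close>: the top increment must stay exact,
      because its negative part \<open>- g n * H m\<close> is what (P2) plays against
      \<open>g m * H m\<close>.\<close>
    have "(\<Sum>k=1..m. g k * (H k - H (k - 1))) \<le> g m * H m"
      using m mono by (intro sum_increments_le_last g1 H0) auto
    then have "(\<Sum>k=1..n. g k * (H k - H (k - 1))) \<le> g m * H m + g n * (H n - H m)"
      using m by simp
    also have "\<dots> = - (((2 * \<sigma> - 1) * g n - \<sigma> * g (n - 1)) * D n (n - 1))"
      unfolding Hn Hn1[unfolded m'] m' by (simp add: algebra_simps)
    also have "\<dots> \<le> 0"
      using last D0 m by simp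
    finally show ?thesis .
  qed
  moreover have "(\<Sum>k=1..n. g k * (H k - H (k - 1))) =
      (\<sigma> * \<xi> n + (1 - \<sigma>) * \<xi> (n - 1)) * (\<Sum>k=1..n. g k * (\<xi> k - \<xi> (k - 1)))
    - (\<Sum>k=1..n. g k * (\<sigma> * (G k n - G (k - 1) n) + (1 - \<sigma>) * (G k (n - 1) - G (k - 1) (n - 1))))"
    unfolding sum_distrib_left sum_subtractf[symmetric]
    by (rule sum.cong) (simp_all add: H_def D_def algebra_simps)
  ultimately show ?thesis by linarith
qed

lemma gcoeff_1_1_nonneg:
  assumes mesh: "temporal_mesh N T t" and \<sigma>: "0 < \<sigma>" and \<beta>: "\<beta> < 1"
  shows "0 \<le> gcoeff t \<sigma> \<beta> 1 1"
proof -
  \<comment> \<open>With unit increments, \<open>delta\<close> at step 1 equals the coefficient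
    itself.\<close>
  define v :: "nat \<Rightarrow> real" where "v k = real k" for k
  have N: "1 \<le> N" using mesh by (simp add: temporal_mesh_def)
  have lt: "t (1 - 1) < t 1"
    using temporal_mesh_less[OF mesh, of 0 1] N by simp
  have "0 \<le> (tstar t \<sigma> 1 - s) powr (- \<beta>) * deriv (Pi1 t 1 v) s" for s
    using lt by (simp add: deriv_Pi1 v_def tau_def del: One_nat_def)
  then have "0 \<le> integral {t (1 - 1)..tstar t \<sigma> 1}
      (\<lambda>s. (tstar t \<sigma> 1 - s) powr (- \<beta>) * deriv (Pi1 t 1 v) s)" (is "0 \<le> integral ?S ?f")
    \<comment> \<open>A non-integrable function has \<open>integral\<close> 0 by convention, so the
      sign of the integrand suffices.\<close>
    by (cases "?f integrable_on ?S") (auto intro: integral_nonneg simp: not_integrable_integral)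
  moreover have "0 < Gamma (1 - \<beta>)"
    using \<beta> by (intro Gamma_real_pos) simp
  ultimately have "0 \<le> delta t \<sigma> \<beta> v 1"
    by (simp add: delta_def)
  then show ?thesis
    using delta_eq_sum_gcoeff[OF mesh _ N \<sigma>, of \<beta> v] by (simp add: v_def)
qed

lemma grid_inner_commute: "grid_inner L M U V = grid_inner L M V U"
  by (simp add: grid_inner_def mult.commute)

lemma grid_inner_self_nonneg: "0 \<le> grid_inner L M U U"
  by (simp add: grid_inner_def sum_nonneg)

lemma grid_inner_Cauchy_Schwarz:
  "grid_inner L M U V \<le> grid_norm L M U * grid_norm L M V"
proof -
  define I where "I = {1..M - 1} \<times> {1..M - 1}"
  \<comment> \<open>Each factor absorbs one mesh width from the weight
    \<open>(L / real M)\<^sup>2\<close>, which leaves an unweighted sum over index pairs.\<close>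
  define f where "f W p = L / real M * W (grid_point L M (fst p) (snd p))" for W :: grid_fun and p
  have eq: "grid_inner L M W X = (\<Sum>p\<in>I. f W p * f X p)" for W X
    by (simp add: grid_inner_def f_def I_def sum.cartesian_product sum_distrib_left
        power2_eq_square case_prod_unfold algebra_simps)
  have "\<bar>grid_inner L M U V\<bar> \<le> sqrt (grid_inner L M U U * grid_inner L M V V)"
    using Cauchy_Schwarz_ineq_sum[of "f U" "f V" I]
    by (intro real_le_rsqrt) (simp add: eq power2_eq_square)
  then show ?thesis
    by (simp add: grid_norm_def real_sqrt_mult)
qed

lemma grid_inner_sum_left:
  "grid_inner L M (\<lambda>p. \<Sum>k\<in>A. c k * F k p) V = (\<Sum>k\<in>A. c k * grid_inner L M (F k) V)"
proof (induction A rule: infinite_finite_induct)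
  case (insert k A)
  then show ?case
    by (simp add: grid_inner_def distrib_right sum.distrib sum_distrib_left algebra_simps)
qed (simp_all add: grid_inner_def)

lemma grid_inner_diff_left:
  "grid_inner L M (\<lambda>p. U p - W p) V = grid_inner L M U V - grid_inner L M W V"
  by (simp add: grid_inner_def left_diff_distrib sum_subtractf right_diff_distrib)

lemma grid_inner_star_right:
  "grid_inner L M U (star_grid \<sigma> v n) =
    \<sigma> * grid_inner L M U (v n) + (1 - \<sigma>) * grid_inner L M U (v (n - 1))"
proof -
  have "grid_inner L M U (\<lambda>p. a * V p + b * W p) = a * grid_inner L M U V + b * grid_inner L M U W"
    for a b V W
    by (simp add: grid_inner_def distrib_left sum.distrib sum_distrib_left mult.left_commute)
  then show ?thesis unfolding star_grid_def .
qed

text \<open>The coefficients do not depend on the grid point, so the pointwise expansion passes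
  through the bilinear inner product and only Gram entries remain.\<close>

lemma grid_inner_delta_star:
  assumes "temporal_mesh N T t" "1 \<le> n" "n \<le> N" "0 < \<sigma>"
  shows "grid_inner L M (delta_grid t \<sigma> \<beta> v n) (star_grid \<sigma> v n) =
    (\<Sum>k=1..n. gcoeff t \<sigma> \<beta> n k *
      (\<sigma> * (grid_inner L M (v k) (v n) - grid_inner L M (v (k - 1)) (v n)) +
       (1 - \<sigma>) * (grid_inner L M (v k) (v (n - 1)) - grid_inner L M (v (k - 1)) (v (n - 1)))))"
  unfolding delta_grid_def delta_eq_sum_gcoeff[OF assms] grid_inner_sum_left
    grid_inner_diff_left grid_inner_star_right
  by (simp add: algebra_simps)

theorem lemma5p2:
  fixes N M n :: nat and T L \<sigma> \<beta> :: real and t \<xi> :: "nat \<Rightarrow> real"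
    and v1 v2 :: "nat \<Rightarrow> grid_fun"
  assumes "temporal_mesh N T t"
    and "0 < L" and "0 < M"
    and "0 < \<beta>" and "\<beta> < 1"
    and "1 / 2 \<le> \<sigma>" and "\<sigma> \<le> 1"
    and P1: "\<forall>n k. 1 \<le> k \<and> k \<le> n - 1 \<and> n - 1 \<le> N - 1 \<longrightarrow>
               gcoeff t \<sigma> \<beta> n (k + 1) > gcoeff t \<sigma> \<beta> n k \<and> gcoeff t \<sigma> \<beta> n k > 0"
    and P2: "\<forall>n. 2 \<le> n \<and> n \<le> N \<longrightarrow>
               (2 * \<sigma> - 1) * gcoeff t \<sigma> \<beta> n n > \<sigma> * gcoeff t \<sigma> \<beta> n (n - 1)"
    and "\<forall>m\<le>N. v1 m \<in> grid_space L M" and "\<forall>m\<le>N. v2 m \<in> grid_space L M"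
    and "\<forall>m\<le>N. \<xi> m = sqrt ((grid_norm L M (v1 m))\<^sup>2 + (grid_norm L M (v2 m))\<^sup>2)"
    and "1 \<le> n" and "n \<le> N"
  shows "grid_inner L M (delta_grid t \<sigma> \<beta> v1 n) (star_grid \<sigma> v1 n) +
         grid_inner L M (delta_grid t \<sigma> \<beta> v2 n) (star_grid \<sigma> v2 n)
       \<ge> (\<sigma> * \<xi> n + (1 - \<sigma>) * \<xi> (n - 1)) * delta t \<sigma> \<beta> \<xi> n"
proof -
  note mesh = assms(1) and n = assms(13,14)
  have \<sigma>: "0 < \<sigma>" using assms(6) by simp
  \<comment> \<open>\<open>\<xi>\<close> is prescribed only up to \<open>N\<close>;
    \<open>\<eta>\<close> satisfies the Gram relations at every index and agrees with
    \<open>\<xi>\<close> up to \<open>n\<close>.\<close>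
  define \<eta> where "\<eta> m = sqrt ((grid_norm L M (v1 m))\<^sup>2 + (grid_norm L M (v2 m))\<^sup>2)" for m
  define G where "G k m = grid_inner L M (v1 k) (v1 m) + grid_inner L M (v2 k) (v2 m)" for k m
  have \<eta>: "\<xi> k = \<eta> k" if "k \<le> n" for k
    using assms(12) n that by (simp add: \<eta>_def)
  have delta: "delta t \<sigma> \<beta> \<xi> n = (\<Sum>k=1..n. gcoeff t \<sigma> \<beta> n k * (\<eta> k - \<eta> (k - 1)))"
    unfolding delta_eq_sum_gcoeff[OF mesh n \<sigma>] by (intro sum.cong) (auto simp: \<eta>)
  have inner: "grid_inner L M (delta_grid t \<sigma> \<beta> v1 n) (star_grid \<sigma> v1 n) +
      grid_inner L M (delta_grid t \<sigma> \<beta> v2 n) (star_grid \<sigma> v2 n) =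
      (\<Sum>k=1..n. gcoeff t \<sigma> \<beta> n k * (\<sigma> * (G k n - G (k - 1) n) +
        (1 - \<sigma>) * (G k (n - 1) - G (k - 1) (n - 1))))"
    unfolding grid_inner_delta_star[OF mesh n \<sigma>] sum.distrib[symmetric]
    by (rule sum.cong) (simp_all add: G_def algebra_simps)
  have g1: "0 \<le> gcoeff t \<sigma> \<beta> n 1"
  proof (cases "n = 1")
    case True
    then show ?thesis using gcoeff_1_1_nonneg[OF mesh \<sigma> assms(5)] by simp
  next
    case False
    then show ?thesis using P1[rule_format, of 1 n] n by linarith
  qed
  have diag: "G m m = \<eta> m * \<eta> m" for m
    by (simp add: G_def \<eta>_def grid_norm_def grid_inner_self_nonneg)
  have CS: "G k m \<le> \<eta> k * \<eta> m" for k m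
  proof -
    have "G k m \<le> grid_norm L M (v1 k) * grid_norm L M (v1 m) +
        grid_norm L M (v2 k) * grid_norm L M (v2 m)"
      unfolding G_def by (intro add_mono grid_inner_Cauchy_Schwarz)
    \<comment> \<open>A second Cauchy--Schwarz inequality, now in the plane, for the pairs of
      norms.\<close>
    also have "\<dots> \<le> \<eta> k * \<eta> m"
      using norm_cauchy_schwarz[of "(grid_norm L M (v1 k), grid_norm L M (v2 k))"
          "(grid_norm L M (v1 m), grid_norm L M (v2 m))"]
      by (simp add: \<eta>_def norm_Pair)
    finally show ?thesis .
  qed
  have "(\<sigma> * \<eta> n + (1 - \<sigma>) * \<eta> (n - 1)) * (\<Sum>k=1..n. gcoeff t \<sigma> \<beta> n k * (\<eta> k - \<eta> (k - 1)))
    \<le> (\<Sum>k=1..n. gcoeff t \<sigma> \<beta> n k * (\<sigma> * (G k n - G (k - 1) n) +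
        (1 - \<sigma>) * (G k (n - 1) - G (k - 1) (n - 1))))"
  proof (rule gram_discrete_derivative_ge[where g = "gcoeff t \<sigma> \<beta> n" and G = G and \<xi> = \<eta>,
        OF n(1) assms(6,7) g1 _ _ diag _ CS])
    show "gcoeff t \<sigma> \<beta> n k \<le> gcoeff t \<sigma> \<beta> n (k + 1)" if "1 \<le> k" "k < n" for k
      using P1[rule_format, of k n] n that by linarith
    show "\<sigma> * gcoeff t \<sigma> \<beta> n (n - 1) \<le> (2 * \<sigma> - 1) * gcoeff t \<sigma> \<beta> n n" if "2 \<le> n"
      using P2[rule_format, of n] n that by simp
    show "G k m = G m k" for k m
      by (simp add: G_def grid_inner_commute)
  qed
  then show ?thesis
    unfolding inner delta by (simp add: \<eta>)
qed

end
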